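(* Let $\mu\in\mathcal V$, let $\overline\mu\in\overline{\mathcal V}$ be a fixed extension of $\mu$ to $\overline K[x]$, and let $\mathcal B=\mathcal B(\overline\mu)$ be the associated chain of closed balls. Then $$\Psi(\mu)=\bigcup_{B\in\mathcal B}p_K\left(\operatorname{Min}_K B\right).$$
   Context: $(K,v)$ is a valued field, $\overline K$ an algebraic closure of $K$, and $v$ also denotes a fixed extension of $v$ to $\overline K$. Put $\Gamma=v\overline K$ and fix an embedding $\Gamma\hookrightarrow\Lambda$ into a divisible (totally) ordered abelian group $\Lambda$. $\mathcal V$ is the set of all $\Lambda$-valued valuations on $K(x)$ whose restriction to $K$ is $v$, identified with valuations $\mu:K[x]\to\Lambda\cup\{\infty\}$ with $\mu^{-1}(\infty)=\{0\}$ and $\mu_{\mid K}=v$; $\overline{\mathcal V}$ is the set of $\Lambda$-valued valuations on $\overline K(x)$ whose restriction to $\overline K$ is $v$. Both are partially ordered by $\mu\le\eta$ iff $\mu(f)\le\eta(f)$ for all polynomials $f$. An extension of $\mu\in\mathcal V$ is $\overline\mu\in\overline{\mathcal V}$ with $\overline\mu_{\mid K[x]}=\mu$. For $(a,\delta)\in\overline K\times\Lambda$: $B(a,\delta)=\{b\in\overline K\mid v(b-a)\ge\delta\}$, and $v_{a,\delta}\in\overline{\mathcal V}$ is given by $v_{a,\delta}\left(\sum_k a_k(x-a)^k\right)=\min_k\{v(a_k)+k\delta\}$. $\mathbb B$ is the set of all balls $B(a,\delta)$, $(a,\delta)\in\overline K\times\Lambda$. For $c\in\overline K$, $p_K(c)\in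 K[x]$ is its minimal polynomial over $K$, and $\deg_K c=\deg p_K(c)$. For $S\subseteq\overline K$: $p_K(S)=\{p_K(c)\mid c\in S\}$, $\deg_K S=\min\{\deg_K c\mid c\in S\}$, $\operatorname{Min}_K S=\{c\in S\mid\deg_K c=\deg_K S\}$. Abstract key polynomials: let $\partial_s$ ($s\ge1$) be the Hasse–Schmidt derivatives on $K[x]$, defined by $f(x+y)=\sum_{s\ge0}(\partial_s f)y^s$. For non-constant $f\in K[x]$, $\epsilon_\mu(f)=\max\{(\mu(f)-\mu(\partial_s f))/s\mid s\ge1,\ \partial_sf\neq0\}\in\Lambda$. A monic non-constant $Q\in K[x]$ is an abstract key polynomial for $\mu$ if for every non-constant $f\in K[x]$, $\deg f<\deg Q$ implies $\epsilon_\mu(f)<\epsilon_\mu(Q)$. $\Psi(\mu)$ is the set of all abstract key polynomials for $\mu$. A valuation $\mu\in\mathcal V$ (value group $\Gamma_\mu$, residue field $k_\mu$) is valuation-transcendental if $\Gamma_\mu/vK$ is not torsion or $k_\mu$ is transcendental over the residue field $Kv$; otherwise it is valuation-algebraic. A family $\{\mu_i\}_{i\in I}$ is increasing if $I$ is totally ordered and $\mu_i<\mu_j$ for $i<j$; $\mu$ is its stable limit if every polynomial $f$ satisfies $\mu_i(f)=\mu(f)$ for all sufficiently large $i$. The chain $\mathcal B(\overline\mu)$: if $\mu$ is valuation-transcendental, then $\overline\mu=v_{a,\delta}$ for some $(a,\delta)\in\overline K\times\Lambda$, and $\mathcal B(\overline\mu)=\{B\in\mathbb B\mid B\supseteq B(a,\delta)\}$.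 If $\mu$ is valuation-algebraic, then $\overline\mu$ is the stable limit of an increasing family $\{\overline\mu_i=v_{a_i,\delta_i}\}_{i\in I}$ in $\overline{\mathcal V}$ extending (member by member) an increasing family $\{\mu_i\}_{i\in I}$ in $\mathcal V$ with stable limit $\mu$; fix such a family, put $B_i=B(a_i,\delta_i)$, and let $\mathcal B(\overline\mu)=\{B\in\mathbb B\mid B\supseteq B_i\text{ for some }i\in I\}$. *)

theory Defs
  imports
    "HOL-Library.Lattice_Constructions"
    "HOL-Computational_Algebra.Computational_Algebra"
    "HOL-Algebra.Algebraic_Closure_Type"
    "HOL-Algebra.Finite_Extensions"
begin

definition (in comm_monoid_add) nmult :: "nat \<Rightarrow> 'a \<Rightarrow> 'a" where
  "nmult n x = (\<Sum>i<n. x)"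

class divisible_linordered_ab_group_add = linordered_ab_group_add +
  assumes divisible: "0 < n \<Longrightarrow> \<exists>y. nmult n y = x"

text \<open>Unique for \<open>0 < n\<close>, since ordered groups are torsion-free.\<close>

definition ndivide :: "'l::divisible_linordered_ab_group_add \<Rightarrow> nat \<Rightarrow> 'l" where
  "ndivide x n = (THE y. nmult n y = x)"

text \<open>
  The type \<open>'l top\<close> is \<open>'l\<close> with a largest element \<open>Top\<close>, which plays the role of
  \<open>\<infinity>\<close>; the addition is extended by \<open>x + \<infinity> = \<infinity> + x = \<infinity>\<close>.
\<close>

instantiation top :: (comm_monoid_add) comm_monoid_add
begin

definition zero_top :: "'a top" where "0 = top.Value 0"

definition plus_top :: "'a top \<Rightarrow> 'a top \<Rightarrow> 'a top" where
  "x + y = (case x of top.Top \<Rightarrow> top.Top | top.Value a \<Rightarrow>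
     (case y of top.Top \<Rightarrow> top.Top | top.Value b \<Rightarrow> top.Value (a + b)))"

instance
  by standard (auto simp: zero_top_def plus_top_def ac_simps split: top.splits)

end

instance top :: (ordered_comm_monoid_add) ordered_comm_monoid_add
  by standard (auto simp: plus_top_def less_eq_top_def add_left_mono split: top.splits)

definition finite_part :: "'l top \<Rightarrow> 'l" where
  "finite_part x = (THE a. x = top.Value a)"

text \<open>Used both for fields and for polynomial rings over a field.\<close>

definition is_valuation :: "('r::idom \<Rightarrow> 'l::linordered_ab_group_add top) \<Rightarrow> bool" where
  "is_valuation w \<longleftrightarrow>
     (\<forall>f. w f = top.Top \<longleftrightarrow> f = 0) \<and>
     (\<forall>f g. w (f * g) = w f + w g) \<and>
     (\<forall>f g. min (w f) (w g) \<le> w (f + g))"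

text \<open>
  The valuations on \<open>F(x)\<close> extending \<open>w\<close>, identified with their restrictions to \<open>F[x]\<close>.
  Their partial order is the library's pointwise order on functions.
\<close>

definition poly_valuations ::
    "('f::field \<Rightarrow> 'l::linordered_ab_group_add top) \<Rightarrow> ('f poly \<Rightarrow> 'l top) set" where
  "poly_valuations w = {\<mu>. is_valuation \<mu> \<and> (\<forall>c. \<mu> [:c:] = w c)}"

text \<open>The valuation \<open>f / g \<mapsto> \<mu> f - \<mu> g\<close> on the field of rational functions.\<close>

definition fract_val ::
    "('f::field poly \<Rightarrow> 'l::linordered_ab_group_add top) \<Rightarrow> 'f poly fract \<Rightarrow> 'l top" where
  "fract_val \<mu> q = (THE y. \<forall>f g. g \<noteq> 0 \<longrightarrow> q = Fract f g \<longrightarrow> y + \<mu> g = \<mu> f)"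

definition value_group :: "('f::field \<Rightarrow> 'l::linordered_ab_group_add top) \<Rightarrow> 'l set" where
  "value_group w = {a. \<exists>x. w x = top.Value a}"

definition val_ring :: "('f::field \<Rightarrow> 'l::linordered_ab_group_add top) \<Rightarrow> 'f ring" where
  "val_ring w = ring_of_type_algebra \<lparr>carrier := {x. 0 \<le> w x}\<rparr>"

definition val_ideal :: "('f::field \<Rightarrow> 'l::linordered_ab_group_add top) \<Rightarrow> 'f set" where
  "val_ideal w = {x. 0 < w x}"

definition residue_field :: "('f::field \<Rightarrow> 'l::linordered_ab_group_add top) \<Rightarrow> 'f set ring" where
  "residue_field w = val_ring w Quot val_ideal w"

text \<open>The canonical image of the residue field of \<open>F\<close> in the residue field of \<open>F(x)\<close>.\<close>

definition base_residue_field ::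
    "('f::field poly \<Rightarrow> 'l::linordered_ab_group_add top) \<Rightarrow> 'f poly fract set set" where
  "base_residue_field \<mu> =
     (\<lambda>c. val_ideal (fract_val \<mu>) +>\<^bsub>val_ring (fract_val \<mu>)\<^esub> Fract [:c:] 1) ` {c. 0 \<le> \<mu> [:c:]}"

definition valuation_transcendental ::
    "('f::field poly \<Rightarrow> 'l::linordered_ab_group_add top) \<Rightarrow> bool" where
  "valuation_transcendental \<mu> \<longleftrightarrow>
     \<not> (\<forall>a \<in> value_group (fract_val \<mu>). \<exists>n>0. nmult n a \<in> value_group (\<lambda>c. \<mu> [:c:])) \<or>
     (\<exists>z \<in> carrier (residue_field (fract_val \<mu>)).
        ring.transcendental (residue_field (fract_val \<mu>)) (base_residue_field \<mu>) z)"

text \<open>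
  \<open>hasse s f\<close> is the coefficient of \<open>y ^ s\<close> in \<open>f(x + y)\<close>, viewed as a polynomial
  in \<open>y\<close> over \<open>F[x]\<close>; the polynomial \<open>x + y\<close> is \<open>[:[:0, 1:], 1:]\<close>.
\<close>

definition hasse :: "nat \<Rightarrow> 'f::field poly \<Rightarrow> 'f poly" where
  "hasse s f = Polynomial.coeff (pcompose (map_poly (\<lambda>c. [:c:]) f) [:[:0, 1:], 1:]) s"

definition eps ::
    "('f::field poly \<Rightarrow> 'l::divisible_linordered_ab_group_add top) \<Rightarrow> 'f poly \<Rightarrow> 'l" where
  "eps \<mu> f = Max {ndivide (finite_part (\<mu> f) - finite_part (\<mu> (hasse s f))) s | s.
                   1 \<le> s \<and> hasse s f \<noteq> 0}"

definition key_polys ::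
    "('f::field poly \<Rightarrow> 'l::divisible_linordered_ab_group_add top) \<Rightarrow> 'f poly set" where
  "key_polys \<mu> = {Q. Polynomial.lead_coeff Q = 1 \<and> 0 < Polynomial.degree Q \<and>
     (\<forall>f. 0 < Polynomial.degree f \<longrightarrow> Polynomial.degree f < Polynomial.degree Q \<longrightarrow>
        eps \<mu> f < eps \<mu> Q)}"

locale algebraic_closure_of =
  fixes \<iota> :: "'k::field \<Rightarrow> 'c::alg_closed_field"
  assumes hom_one: "\<iota> 1 = 1"
    and hom_add: "\<iota> (a + b) = \<iota> a + \<iota> b"
    and hom_mult: "\<iota> (a * b) = \<iota> a * \<iota> b"
    and algebraic: "\<exists>p. p \<noteq> 0 \<and> poly (map_poly \<iota> p) c = 0"

definition min_poly :: "('k::field \<Rightarrow> 'c::field) \<Rightarrow> 'c \<Rightarrow> 'k poly" where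
  "min_poly \<iota> c = (THE p. Polynomial.lead_coeff p = 1 \<and> poly (map_poly \<iota> p) c = 0 \<and>
     (\<forall>q. q \<noteq> 0 \<longrightarrow> poly (map_poly \<iota> q) c = 0 \<longrightarrow> Polynomial.degree p \<le> Polynomial.degree q))"

definition deg_over :: "('k::field \<Rightarrow> 'c::field) \<Rightarrow> 'c \<Rightarrow> nat" where
  "deg_over \<iota> c = Polynomial.degree (min_poly \<iota> c)"

definition deg_over_set :: "('k::field \<Rightarrow> 'c::field) \<Rightarrow> 'c set \<Rightarrow> nat" where
  "deg_over_set \<iota> S = (LEAST n. n \<in> deg_over \<iota> ` S)"

definition Min_over :: "('k::field \<Rightarrow> 'c::field) \<Rightarrow> 'c set \<Rightarrow> 'c set" where
  "Min_over \<iota> S = {c \<in> S. deg_over \<iota> c = deg_over_set \<iota> S}"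

definition val_ball ::
    "('c::field \<Rightarrow> 'l::linordered_ab_group_add top) \<Rightarrow> 'c \<Rightarrow> 'l \<Rightarrow> 'c set" where
  "val_ball v a \<delta> = {b. top.Value \<delta> \<le> v (b - a)}"

definition val_balls :: "('c::field \<Rightarrow> 'l::linordered_ab_group_add top) \<Rightarrow> 'c set set" where
  "val_balls v = {val_ball v a \<delta> | a \<delta>. True}"

text \<open>The coefficients of the \<open>(x - a)\<close>-expansion of \<open>f\<close> are those of \<open>f(x + a)\<close>.\<close>

definition ball_val ::
    "('c::field \<Rightarrow> 'l::linordered_ab_group_add top) \<Rightarrow> 'c \<Rightarrow> 'l \<Rightarrow> 'c poly \<Rightarrow> 'l top" where
  "ball_val v a \<delta> f =
     Min ((\<lambda>k. v (Polynomial.coeff (pcompose f [:a, 1:]) k) + top.Value (nmult k \<delta>))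
            ` {..Polynomial.degree f})"

text \<open>Increasing families indexed by \<open>I\<close> are expressed by \<open>strict_mono_on I\<close>.\<close>

definition stable_limit ::
    "'i::linorder set \<Rightarrow> ('i \<Rightarrow> 'p \<Rightarrow> 'l) \<Rightarrow> ('p \<Rightarrow> 'l) \<Rightarrow> bool" where
  "stable_limit I \<mu>s \<mu> \<longleftrightarrow> (\<forall>f. \<exists>i0\<in>I. \<forall>i\<in>I. i0 \<le> i \<longrightarrow> \<mu>s i f = \<mu> f)"

text \<open>
  \<open>ball_chain \<iota> v I \<mu> \<mu>' BB\<close>: the set of balls \<open>BB\<close> is a chain associated with the
  extension \<open>\<mu>'\<close> of \<open>\<mu>\<close>, for some admissible choice of the defining data. The index set
  \<open>I\<close> of the family is only used in the valuation-algebraic case; it is a parameter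
  because its type cannot be existentially quantified.
\<close>

definition ball_chain ::
    "('k::field \<Rightarrow> 'c::field) \<Rightarrow> ('c \<Rightarrow> 'l::linordered_ab_group_add top) \<Rightarrow> 'i::linorder set \<Rightarrow>
     ('k poly \<Rightarrow> 'l top) \<Rightarrow> ('c poly \<Rightarrow> 'l top) \<Rightarrow> 'c set set \<Rightarrow> bool" where
  "ball_chain \<iota> v I \<mu> \<mu>' BB \<longleftrightarrow>
     (if valuation_transcendental \<mu> then
        \<exists>a \<delta>. \<mu>' = ball_val v a \<delta> \<and> BB = {B \<in> val_balls v. val_ball v a \<delta> \<subseteq> B}
      else
        \<exists>a \<delta> \<mu>s.
          (\<forall>i\<in>I. ball_val v (a i) (\<delta> i) \<in> poly_valuations v) \<and>
          strict_mono_on I (\<lambda>i. ball_val v (a i) (\<delta> i)) \<and>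
          stable_limit I (\<lambda>i. ball_val v (a i) (\<delta> i)) \<mu>' \<and>
          (\<forall>i\<in>I. \<mu>s i \<in> poly_valuations (v \<circ> \<iota>)) \<and>
          strict_mono_on I \<mu>s \<and>
          stable_limit I \<mu>s \<mu> \<and>
          (\<forall>i\<in>I. ball_val v (a i) (\<delta> i) \<circ> map_poly \<iota> = \<mu>s i) \<and>
          BB = {B \<in> val_balls v. \<exists>i\<in>I. val_ball v (a i) (\<delta> i) \<subseteq> B})"

end

theory Submission
  imports Defs
begin

text \<open>
  Over the algebraic closure a non-constant \<open>f\<close> splits into linear factors, and \<open>\<epsilon>\<^bsub>\<mu>\<^esub>(f)\<close> is the
  largest value \<open>\<mu>'(x - b)\<close> over the roots \<open>b\<close> of \<open>f\<close>. On the other hand, the chain of balls consists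
  of the nonempty sets \<open>{b. \<gamma> \<le> \<mu>'(x - b)}\<close>. So a monic \<open>Q\<close> is a key polynomial iff it is the
  minimal polynomial of an element of least degree in the set given by \<open>\<gamma> = \<epsilon>\<^bsub>\<mu>\<^esub>(Q)\<close>.
\<close>

section \<open>Ordered groups with infinity\<close>

lemma nmult_0 [simp]: "nmult 0 (x::'a::comm_monoid_add) = 0"
  by (simp add: nmult_def)

lemma nmult_Suc: "nmult (Suc n) (x::'a::comm_monoid_add) = x + nmult n x"
  by (simp add: nmult_def add.commute)

lemma nmult_strict_mono:
  fixes x y :: "'a::linordered_ab_group_add"
  assumes "x < y" "0 < n"
  shows "nmult n x < nmult n y"
  unfolding nmult_def using assms by (intro sum_strict_mono) auto

lemma nmult_le_iff:
  fixes x y :: "'a::linordered_ab_group_add"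
  assumes "0 < n"
  shows "nmult n x \<le> nmult n y \<longleftrightarrow> x \<le> y"
  using nmult_strict_mono[of x y n] nmult_strict_mono[of y x n] assms
  by (metis linorder_less_linear not_less order.strict_iff_order)

text \<open>Divisibility gives existence and strict monotonicity of \<open>nmult n\<close> gives
  uniqueness, so the \<open>THE\<close> in \<open>ndivide\<close> is well defined.\<close>

lemma nmult_ndivide:
  fixes x :: "'a::divisible_linordered_ab_group_add"
  assumes "0 < n"
  shows "nmult n (ndivide x n) = x"
proof -
  obtain y where y: "nmult n y = x"
    using divisible[OF assms] by blast
  have "z = y" if "nmult n z = x" for z
    using that y nmult_le_iff[OF assms, of y z] nmult_le_iff[OF assms, of z y] by simp
  with y have "ndivide x n = y"
    unfolding ndivide_def by (intro the_equality)
  with y show ?thesis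
    by simp
qed

lemma ndivide_le_iff:
  fixes x :: "'a::divisible_linordered_ab_group_add"
  assumes "0 < n"
  shows "ndivide x n \<le> d \<longleftrightarrow> x \<le> nmult n d"
  using nmult_le_iff[OF assms, of "ndivide x n" d] nmult_ndivide[OF assms, of x] by simp

lemma le_ndivide_iff:
  fixes x :: "'a::divisible_linordered_ab_group_add"
  assumes "0 < n"
  shows "d \<le> ndivide x n \<longleftrightarrow> nmult n d \<le> x"
  using nmult_le_iff[OF assms, of d "ndivide x n"] nmult_ndivide[OF assms, of x] by simp

lemma Value_plus_Value [simp]: "top.Value a + top.Value b = top.Value (a + b)"
  by (simp add: plus_top_def)

lemma Top_plus [simp]: "top.Top + x = top.Top" "x + top.Top = top.Top"
  by (auto simp: plus_top_def split: top.splits)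

text \<open>Infinity has no negative, so only finite amounts are moved across an inequality.\<close>

lemma le_plus_Value_iff:
  fixes x y :: "'l::linordered_ab_group_add top"
  shows "x \<le> y + top.Value d \<longleftrightarrow> x + top.Value (- d) \<le> y"
proof (cases x; cases y)
  fix a b
  show "x = top.Value a \<Longrightarrow> y = top.Value b \<Longrightarrow> ?thesis"
    using diff_le_eq[of a d b] by simp
qed auto

lemma finite_part_Value [simp]: "finite_part (top.Value a) = a"
  by (simp add: finite_part_def)

section \<open>Valuations\<close>

locale valuation =
  fixes w :: "'r::idom \<Rightarrow> 'l::linordered_ab_group_add top"
  assumes is_valuation: "is_valuation w"
begin

lemma eq_Top_iff: "w f = top.Top \<longleftrightarrow> f = 0"
  using is_valuation by (simp add: is_valuation_def)

lemma mult: "w (f * g) = w f + w g"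
  using is_valuation by (simp add: is_valuation_def)

lemma add_ge: "min (w f) (w g) \<le> w (f + g)"
  using is_valuation by (simp add: is_valuation_def)

lemma zero [simp]: "w 0 = top.Top"
  by (simp add: eq_Top_iff)

lemma nonzeroE:
  assumes "f \<noteq> 0"
  obtains a where "w f = top.Value a"
  using assms eq_Top_iff[of f] by (cases "w f") auto

lemma one [simp]: "w 1 = 0"
proof -
  obtain a where a: "w 1 = top.Value a"
    by (rule nonzeroE[of 1]) auto
  with mult[of 1 1] show ?thesis
    by (simp add: zero_top_def)
qed

lemma minus [simp]: "w (- f) = w f"
proof -
  obtain a where a: "w (- 1) = top.Value a"
    by (rule nonzeroE[of "- 1"]) auto
  with mult[of "- 1" "- 1"] have "a + a = 0"
    by (simp add: zero_top_def)
  \<comment> \<open>An ordered group has no torsion, so \<open>a + a = 0\<close> forces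
    \<open>a = 0\<close>.\<close>
  then have "w (- 1) = 0"
    using a by (simp add: zero_top_def double_zero)
  with mult[of "- 1" f] show ?thesis
    by simp
qed

lemma power: "w f = top.Value a \<Longrightarrow> w (f ^ n) = top.Value (nmult n a)"
  by (induction n) (simp_all add: mult nmult_Suc zero_top_def)

lemma add_geI: "a \<le> w f \<Longrightarrow> a \<le> w g \<Longrightarrow> a \<le> w (f + g)"
  using add_ge[of f g] by (meson min.boundedI order_trans)

lemma diff_geI: "a \<le> w f \<Longrightarrow> a \<le> w g \<Longrightarrow> a \<le> w (f - g)"
  using add_geI[of a f "- g"] by simp

lemma sum_gt:
  assumes "finite A" "\<And>i. i \<in> A \<Longrightarrow> top.Value a < w (f i)"
  shows "top.Value a < w (sum f A)"
  using assms
proof (induction A rule: finite_induct)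
  case (insert i A)
  then have "top.Value a < min (w (f i)) (w (sum f A))"
    by simp
  also have "\<dots> \<le> w (sum f (insert i A))"
    using add_ge insert.hyps by simp
  finally show ?case .
qed simp

end

section \<open>Hasse--Schmidt derivatives\<close>

definition taylor :: "'f::field poly \<Rightarrow> 'f poly poly" where
  "taylor f = pcompose (map_poly (\<lambda>c. [:c:]) f) [:[:0, 1:], 1:]"

lemma coeff_taylor: "Polynomial.coeff (taylor f) s = hasse s f"
  by (simp add: hasse_def taylor_def)

text \<open>Substituting x + y into a + x f(x) turns the factor x into x + y. Comparing coefficients
  of powers of y then gives the recursion for \<open>hasse\<close>.\<close>

lemma taylor_pCons: "taylor (pCons a f) = [:[:a:]:] + [:[:0, 1:], 1:] * taylor f"
  by (simp add: taylor_def map_poly_pCons pcompose_pCons)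

lemma hasse_0_left [simp]: "hasse 0 f = f"
proof (induction f)
  case 0
  show ?case by (simp add: hasse_def)
next
  case (pCons a f)
  then show ?case
    by (simp add: taylor_pCons flip: coeff_taylor)
qed

lemma hasse_0_right [simp]: "hasse s 0 = 0"
  by (simp add: hasse_def)

lemma hasse_Suc_pCons: "hasse (Suc s) (pCons a f) = pCons 0 (hasse (Suc s) f) + hasse s f"
  by (simp add: taylor_pCons flip: coeff_taylor)

lemma hasse_add: "hasse s (f + g) = hasse s f + hasse s g"
proof -
  have "map_poly (\<lambda>c. [:c:]) (f + g) = map_poly (\<lambda>c. [:c:]) f + map_poly (\<lambda>c. [:c:]) g"
    by (intro poly_eqI) (simp add: coeff_map_poly)
  then show ?thesis
    by (simp add: hasse_def pcompose_add)
qed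

lemma hasse_smult: "hasse s (Polynomial.smult c f) = Polynomial.smult c (hasse s f)"
proof -
  have "map_poly (\<lambda>c. [:c:]) (Polynomial.smult c f) = Polynomial.smult [:c:] (map_poly (\<lambda>c. [:c:]) f)"
    by (intro poly_eqI) (simp add: coeff_map_poly mult.commute)
  then show ?thesis
    by (simp add: hasse_def pcompose_smult)
qed

text \<open>Leibniz rule for a linear factor, whose only non-zero derivatives are itself in order 0
  and 1 in order 1. It drives the induction over the roots.\<close>

lemma hasse_Suc_linear_mult:
  "hasse (Suc s) ([:a, 1:] * f) = [:a, 1:] * hasse (Suc s) f + hasse s f"
proof -
  have "[:a, 1:] * g = Polynomial.smult a g + pCons 0 g" for g
    by simp
  then show ?thesis
    by (simp add: hasse_add hasse_smult hasse_Suc_pCons)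
qed

lemma hasse_eq_0: "Polynomial.degree f < s \<Longrightarrow> hasse s f = 0"
proof (induction f arbitrary: s)
  case (pCons a f)
  then show ?case
    by (cases s) (simp_all add: hasse_Suc_pCons split: if_splits)
qed simp

text \<open>The sum is f(x + y) at y = b - x, which is the constant f(b).\<close>

lemma taylor_root:
  assumes "poly f b = 0"
  shows "(\<Sum>s\<le>Polynomial.degree f. hasse s f * [:b, - 1:] ^ s) = 0"
proof -
  have lift: "poly (map_poly (\<lambda>c. [:c:]) g) [:b:] = [:poly g b:]" for g
    by (induction g) (simp_all add: map_poly_pCons)
  have deg: "Polynomial.degree (taylor f) \<le> Polynomial.degree f"
    by (rule Polynomial.degree_le) (simp add: coeff_taylor hasse_eq_0)
  have "(\<Sum>s\<le>Polynomial.degree f. hasse s f * [:b, - 1:] ^ s)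
      = (\<Sum>s\<le>Polynomial.degree (taylor f). hasse s f * [:b, - 1:] ^ s)"
    using deg by (intro sum.mono_neutral_right) (auto simp: not_le Polynomial.coeff_eq_0 simp flip: coeff_taylor)
  also have "\<dots> = poly (taylor f) [:b, - 1:]"
    by (simp add: poly_altdef coeff_taylor)
  \<comment> \<open>The inner polynomial x + y evaluates to the constant polynomial b, and
    \<open>lift\<close> turns evaluation there into evaluation at b.\<close>
  also have "\<dots> = [:poly f b:]"
    by (simp add: taylor_def poly_pcompose lift)
  finally show ?thesis
    using assms by simp
qed

section \<open>The invariant \<open>\<epsilon>\<close> as the largest value at a root\<close>

text \<open>A derivative of order s of a product of linear factors is a sum of products with s
  factors removed, and removing a factor x - b costs at most \<delta>. The Leibniz rule makes this
  an induction on the multiset of roots.\<close>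

lemma le_hasse:
  fixes w :: "'c::alg_closed_field poly \<Rightarrow> 'l::linordered_ab_group_add top"
  assumes "is_valuation w" "f \<noteq> 0"
    and roots: "\<And>b. poly f b = 0 \<Longrightarrow> w [:- b, 1:] \<le> top.Value \<delta>"
  shows "w f \<le> w (hasse s f) + top.Value (nmult s \<delta>)"
proof -
  interpret valuation w by unfold_locales fact
  define c where "c = Polynomial.lead_coeff f"
  obtain A where A: "f = Polynomial.smult c (\<Prod>b\<in>#A. [:- b, 1:])"
    using alg_closed_imp_factorization[OF \<open>f \<noteq> 0\<close>] unfolding c_def by blast
  have "w [:- b, 1:] \<le> top.Value \<delta>" if "b \<in># A" for b
  proof (rule roots)
    show "poly f b = 0"
      using that unfolding A by (auto simp: poly_prod_mset prod_mset_zero_iff)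
  qed
  then show ?thesis
    unfolding A
  proof (induction A arbitrary: s)
    \<comment> \<open>The polynomial is constant, so its derivatives of positive order vanish and
      have value \<open>Top\<close>.\<close>
    case empty
    show ?case
      by (cases s) (simp_all add: hasse_Suc_pCons hasse_eq_0 flip: zero_top_def)
  next
    case (add b A)
    define g where "g = Polynomial.smult c (\<Prod>b\<in>#A. [:- b, 1:])"
    have step: "Polynomial.smult c (\<Prod>b\<in>#add_mset b A. [:- b, 1:]) = [:- b, 1:] * g"
      by (simp add: g_def algebra_simps smult_add_right)
    have IH: "w g \<le> w (hasse s g) + top.Value (nmult s \<delta>)" for s
      unfolding g_def using add by simp
    show ?case
    proof (cases s)
      case 0
      then show ?thesis
        by (simp flip: zero_top_def)
    next
      case (Suc t)
      \<comment> \<open>The claim with \<open>nmult s \<delta>\<close> moved to the left says that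
        \<sigma> bounds the derivative from below. Both Leibniz terms are shown to satisfy this
        bound.\<close>
      define \<sigma> where "\<sigma> = w [:- b, 1:] + w g + top.Value (- nmult s \<delta>)"
      have "w g + top.Value (- nmult s \<delta>) \<le> w (hasse s g)"
        using IH[of s] by (simp add: le_plus_Value_iff)
      then have "\<sigma> \<le> w ([:- b, 1:] * hasse s g)"
        unfolding \<sigma>_def mult add.assoc by (rule add_left_mono)
      \<comment> \<open>The second term has lost the factor x - b; one of the s = t + 1 copies of
        \<delta> pays for it.\<close>
      moreover have "\<sigma> \<le> top.Value \<delta> + w g + top.Value (- nmult s \<delta>)"
        unfolding \<sigma>_def using add.prems[of b] by (intro add_right_mono) simp
      then have "\<sigma> \<le> w g + top.Value (- nmult t \<delta>)"
        by (cases "w g") (simp_all add: Suc nmult_Suc)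
      then have "\<sigma> \<le> w (hasse t g)"
        using IH[of t, unfolded le_plus_Value_iff] by (rule order_trans)
      ultimately have "\<sigma> \<le> w (hasse s ([:- b, 1:] * g))"
        unfolding Suc hasse_Suc_linear_mult by (rule add_geI)
      then show ?thesis
        unfolding step le_plus_Value_iff \<sigma>_def mult[of "[:- b, 1:]" g] .
    qed
  qed
qed

text \<open>Evaluating \<open>f(x + y)\<close> at \<open>y = b - x\<close> gives \<open>0\<close>, so \<open>f\<close> cannot have strictly the least value
  among the terms of the Taylor expansion.\<close>

lemma ex_hasse_le:
  fixes w :: "'f::field poly \<Rightarrow> 'l::linordered_ab_group_add top"
  assumes "is_valuation w" "f \<noteq> 0" "poly f b = 0" and \<delta>: "w [:- b, 1:] = top.Value \<delta>"
  shows "\<exists>s\<ge>1. w (hasse s f) + top.Value (nmult s \<delta>) \<le> w f"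
proof (rule ccontr)
  assume "\<not> ?thesis"
  then have less: "w f < w (hasse s f) + top.Value (nmult s \<delta>)" if "1 \<le> s" for s
    using that by (meson not_le)
  interpret valuation w by unfold_locales fact
  obtain a where a: "w f = top.Value a"
    using nonzeroE[OF \<open>f \<noteq> 0\<close>] .
  define S where "S = (\<Sum>s=1..Polynomial.degree f. hasse s f * [:b, - 1:] ^ s)"
  have "w [:b, - 1:] = top.Value \<delta>"
    using minus[of "[:- b, 1:]"] \<delta> by simp
  then have "top.Value a < w S"
    unfolding S_def using less a by (intro sum_gt) (auto simp: mult power)
  moreover have "{..Polynomial.degree f} = insert 0 {1..Polynomial.degree f}"
    by auto
  \<comment> \<open>The summand of index 0 is f itself, so S = -f has the same value as f.\<close>
  then have "f + S = 0"
    using taylor_root[OF \<open>poly f b = 0\<close>] by (simp add: S_def)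
  then have "w S = top.Value a"
    using a minus[of f] by (simp add: add_eq_0_iff)
  ultimately show False
    by simp
qed

section \<open>Minimal polynomials\<close>

context algebraic_closure_of
begin

lemma hom_zero [simp]: "\<iota> 0 = 0"
  using hom_add[of 0 0] by (metis add.right_neutral add_left_cancel)

lemma hom_eq_0_iff [simp]: "\<iota> a = 0 \<longleftrightarrow> a = 0"
proof
  assume "\<iota> a = 0"
  show "a = 0"
  proof (rule ccontr)
    assume "a \<noteq> 0"
    then have "\<iota> a * \<iota> (inverse a) = 1"
      by (simp add: hom_one flip: hom_mult)
    with \<open>\<iota> a = 0\<close> show False
      by simp
  qed
qed simp

lemma degree_hom_poly [simp]: "Polynomial.degree (map_poly \<iota> p) = Polynomial.degree p"
  by (rule Polynomial.degree_map_poly) simp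

lemma hom_poly_eq_0_iff [simp]: "map_poly \<iota> p = 0 \<longleftrightarrow> p = 0"
  by (auto simp: poly_eq_iff coeff_map_poly)

lemma hom_poly_add: "map_poly \<iota> (p + q) = map_poly \<iota> p + map_poly \<iota> q"
  by (intro poly_eqI) (simp add: coeff_map_poly hom_add)

lemma hom_poly_diff: "map_poly \<iota> (p - q) = map_poly \<iota> p - map_poly \<iota> q"
  using hom_poly_add[of "p - q" q] by simp

lemma hom_poly_smult: "map_poly \<iota> (Polynomial.smult a p) = Polynomial.smult (\<iota> a) (map_poly \<iota> p)"
  by (intro poly_eqI) (simp add: coeff_map_poly hom_mult)

lemma hom_poly_pCons: "map_poly \<iota> (pCons a p) = pCons (\<iota> a) (map_poly \<iota> p)"
  by (simp add: map_poly_pCons)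

text \<open>Transfers the computation of \<epsilon> from the base field to its closure, where
  polynomials split.\<close>

lemma hom_poly_hasse: "map_poly \<iota> (hasse s f) = hasse s (map_poly \<iota> f)"
proof (induction f arbitrary: s)
  case (pCons a f)
  then show ?case
    by (cases s) (simp_all add: hasse_Suc_pCons hom_poly_pCons hom_poly_add)
qed simp

text \<open>The condition under \<open>THE\<close> in \<open>min_poly\<close>, named so that
  existence and uniqueness can be stated for it.\<close>

definition is_min_poly :: "'k poly \<Rightarrow> 'c \<Rightarrow> bool" where
  "is_min_poly p c \<longleftrightarrow> Polynomial.lead_coeff p = 1 \<and> poly (map_poly \<iota> p) c = 0 \<and>
     (\<forall>q. q \<noteq> 0 \<longrightarrow> poly (map_poly \<iota> q) c = 0 \<longrightarrow> Polynomial.degree p \<le> Polynomial.degree q)"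

lemma ex_is_min_poly: "\<exists>p. is_min_poly p c"
proof -
  let ?P = "\<lambda>p. p \<noteq> 0 \<and> poly (map_poly \<iota> p) c = 0"
  obtain p where p: "?P p" "\<And>q. ?P q \<Longrightarrow> Polynomial.degree p \<le> Polynomial.degree q"
    using algebraic[of c] ex_has_least_nat[of ?P _ Polynomial.degree] by blast
  then have "is_min_poly (Polynomial.smult (inverse (Polynomial.lead_coeff p)) p) c"
    unfolding is_min_poly_def by (auto simp: hom_poly_smult)
  then show ?thesis ..
qed

text \<open>Both polynomials are monic of the same degree, so their difference has smaller degree;
  it vanishes at c, against minimality.\<close>

lemma is_min_poly_unique:
  assumes "is_min_poly p c" "is_min_poly q c"
  shows "p = q"
proof (rule ccontr)
  assume "p \<noteq> q"
  have deg: "Polynomial.degree p = Polynomial.degree q"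
    using assms unfolding is_min_poly_def by (metis le_antisym leading_coeff_0_iff zero_neq_one)
  have "poly (map_poly \<iota> (p - q)) c = 0"
    using assms by (simp add: is_min_poly_def hom_poly_diff)
  then have "Polynomial.degree p \<le> Polynomial.degree (p - q)"
    using assms \<open>p \<noteq> q\<close> by (simp add: is_min_poly_def)
  moreover have "Polynomial.coeff (p - q) (Polynomial.degree p) = 0"
    using assms deg by (simp add: is_min_poly_def)
  moreover have "Polynomial.degree (p - q) \<le> Polynomial.degree p"
    using deg by (simp add: Polynomial.degree_diff_le)
  ultimately show False
    using \<open>p \<noteq> q\<close> by (metis eq_iff_diff_eq_0 le_antisym leading_coeff_0_iff)
qed

lemma min_poly_eqI: "is_min_poly p c \<Longrightarrow> min_poly \<iota> c = p"
  unfolding min_poly_def is_min_poly_def[symmetric]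
  by (rule the_equality) (auto intro: is_min_poly_unique)

lemma is_min_poly_min_poly: "is_min_poly (min_poly \<iota> c) c"
  using ex_is_min_poly[of c] min_poly_eqI by metis

lemma lead_coeff_min_poly: "Polynomial.lead_coeff (min_poly \<iota> c) = 1"
  using is_min_poly_min_poly by (simp add: is_min_poly_def)

lemma poly_min_poly: "poly (map_poly \<iota> (min_poly \<iota> c)) c = 0"
  using is_min_poly_min_poly by (simp add: is_min_poly_def)

lemma deg_over_le: "q \<noteq> 0 \<Longrightarrow> poly (map_poly \<iota> q) c = 0 \<Longrightarrow> deg_over \<iota> c \<le> Polynomial.degree q"
  using is_min_poly_min_poly by (simp add: is_min_poly_def deg_over_def)

lemma deg_over_pos: "0 < deg_over \<iota> c"
proof (rule ccontr)
  assume "\<not> ?thesis"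
  then obtain a where "min_poly \<iota> c = [:a:]"
    by (auto simp: deg_over_def elim: degree_eq_zeroE)
  with lead_coeff_min_poly[of c] poly_min_poly[of c] show False
    by (simp add: hom_poly_pCons hom_one)
qed

text \<open>Recognizes a minimal polynomial by its degree alone, without an argument on divisibility
  or irreducibility.\<close>

lemma min_poly_eq_of_degree:
  assumes "Polynomial.lead_coeff Q = 1" "poly (map_poly \<iota> Q) c = 0"
    and "deg_over \<iota> c = Polynomial.degree Q"
  shows "min_poly \<iota> c = Q"
  using assms deg_over_le[of _ c] by (intro min_poly_eqI) (auto simp: is_min_poly_def)

end

lemma Min_over_iff:
  "c \<in> Min_over \<iota> S \<longleftrightarrow> c \<in> S \<and> (\<forall>b\<in>S. deg_over \<iota> c \<le> deg_over \<iota> b)"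
proof (cases "c \<in> S")
  case True
  have "deg_over_set \<iota> S \<in> deg_over \<iota> ` S"
    unfolding deg_over_set_def using True by (intro LeastI) auto
  moreover have "deg_over_set \<iota> S \<le> deg_over \<iota> b" if "b \<in> S" for b
    unfolding deg_over_set_def using that by (intro Least_le) auto
  ultimately show ?thesis
    using True by (auto simp: Min_over_def intro: le_antisym)
qed (simp add: Min_over_def)

lemma Min_overD: "c \<in> Min_over \<iota> S \<Longrightarrow> c \<in> S"
  by (simp add: Min_over_def)

section \<open>Key polynomials\<close>

context algebraic_closure_of
begin

text \<open>By \<open>le_hasse\<close> every slope is at most \<delta>, and by
  \<open>ex_hasse_le\<close> at the root of largest value some slope is at least \<delta>.\<close>

lemma eps_eqI:
  fixes w :: "'c poly \<Rightarrow> 'l::divisible_linordered_ab_group_add top"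
  assumes "is_valuation w" and f: "0 < Polynomial.degree f"
    and b: "poly (map_poly \<iota> f) b = 0" "w [:- b, 1:] = top.Value \<delta>"
    and max: "\<And>b. poly (map_poly \<iota> f) b = 0 \<Longrightarrow> w [:- b, 1:] \<le> top.Value \<delta>"
  shows "eps (w \<circ> map_poly \<iota>) f = \<delta>"
proof -
  interpret valuation w by unfold_locales fact
  define F where "F = map_poly \<iota> f"
  have F: "F \<noteq> 0" "Polynomial.degree F = Polynomial.degree f"
    using f by (auto simp: F_def)
  define slope where "slope s = ndivide (finite_part (w F) - finite_part (w (hasse s F))) s" for s
  have eps: "eps (w \<circ> map_poly \<iota>) f = Max {slope s | s. 1 \<le> s \<and> hasse s F \<noteq> 0}"
  proof -
    have "hasse s f \<noteq> 0 \<longleftrightarrow> hasse s F \<noteq> 0" for s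
      by (simp add: F_def flip: hom_poly_hasse)
    then show ?thesis
      by (simp add: eps_def slope_def F_def hom_poly_hasse)
  qed
  obtain \<phi> where \<phi>: "w F = top.Value \<phi>"
    using nonzeroE[OF \<open>F \<noteq> 0\<close>] .
  have le: "slope s \<le> \<delta>" if s: "1 \<le> s" "hasse s F \<noteq> 0" for s
  proof -
    obtain \<psi> where \<psi>: "w (hasse s F) = top.Value \<psi>"
      using nonzeroE[OF s(2)] .
    have "w F \<le> w (hasse s F) + top.Value (nmult s \<delta>)"
      using max F(1) by (intro le_hasse assms) (auto simp: F_def)
    then show ?thesis
      using s(1) \<phi> \<psi> by (simp add: slope_def ndivide_le_iff algebra_simps)
  qed
  obtain s where s: "1 \<le> s" "w (hasse s F) + top.Value (nmult s \<delta>) \<le> w F"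
    using ex_hasse_le[of w F b \<delta>] assms(1) F(1) b by (auto simp: F_def)
  \<comment> \<open>As \<open>w F\<close> is finite, the inequality excludes the value
    \<open>Top\<close>; hence this derivative is non-zero and its slope enters the maximum.\<close>
  then obtain \<psi> where \<psi>: "w (hasse s F) = top.Value \<psi>"
    using \<phi> by (cases "w (hasse s F)") auto
  then have ne: "hasse s F \<noteq> 0"
    by auto
  have "\<delta> \<le> slope s"
    using s \<phi> \<psi> by (simp add: slope_def le_ndivide_iff algebra_simps)
  with le[OF s(1) ne] have "slope s = \<delta>"
    by (rule order_antisym)
  have "s \<le> Polynomial.degree F" if "hasse s F \<noteq> 0" for s
    using that hasse_eq_0[of F s] by (meson not_le)
  then have "{slope s | s. 1 \<le> s \<and> hasse s F \<noteq> 0} \<subseteq> slope ` {..Polynomial.degree F}"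
    by blast
  then have "finite {slope s | s. 1 \<le> s \<and> hasse s F \<noteq> 0}"
    by (rule finite_subset) simp
  then show ?thesis
    unfolding eps
  proof (rule Max_eqI)
    show "\<delta> \<in> {slope s | s. 1 \<le> s \<and> hasse s F \<noteq> 0}"
      using \<open>slope s = \<delta>\<close> s(1) ne by blast
  qed (use le in blast)
qed

text \<open>The root set is finite, and non-empty since the field is algebraically closed; a root of
  largest value meets the hypotheses of \<open>eps_eqI\<close>.\<close>

lemma obtain_eps:
  fixes w :: "'c poly \<Rightarrow> 'l::divisible_linordered_ab_group_add top"
  assumes "is_valuation w" and f: "0 < Polynomial.degree f"
  obtains b where "poly (map_poly \<iota> f) b = 0" "w [:- b, 1:] = top.Value (eps (w \<circ> map_poly \<iota>) f)"
    "\<And>b. poly (map_poly \<iota> f) b = 0 \<Longrightarrow> w [:- b, 1:] \<le> top.Value (eps (w \<circ> map_poly \<iota>) f)"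
proof -
  interpret valuation w by unfold_locales fact
  define R where "R = {b. poly (map_poly \<iota> f) b = 0}"
  have "finite R"
    unfolding R_def using f by (intro poly_roots_finite) auto
  moreover have "R \<noteq> {}"
    unfolding R_def using f alg_closed_imp_poly_has_root[of "map_poly \<iota> f"] by auto
  ultimately have "Max ((\<lambda>b. w [:- b, 1:]) ` R) \<in> (\<lambda>b. w [:- b, 1:]) ` R"
    by (intro Max_in) auto
  then obtain b where b: "b \<in> R" "Max ((\<lambda>b. w [:- b, 1:]) ` R) = w [:- b, 1:]"
    by blast
  have max: "w [:- c, 1:] \<le> w [:- b, 1:]" if "c \<in> R" for c
    unfolding b(2)[symmetric] using that \<open>finite R\<close> by (intro Max_ge) auto
  obtain \<delta> where \<delta>: "w [:- b, 1:] = top.Value \<delta>"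
    by (rule nonzeroE[of "[:- b, 1:]"]) auto
  have "eps (w \<circ> map_poly \<iota>) f = \<delta>"
    using b max \<delta> by (intro eps_eqI[OF assms]) (auto simp: R_def)
  with that[of b] b max \<delta> show thesis
    by (auto simp: R_def)
qed

text \<open>Left to right, \<gamma> is the \<epsilon> of Q, and an element of smaller degree in the
  level set would have a minimal polynomial of smaller degree with \<epsilon> at least \<gamma>.
  Right to left, all roots of a polynomial of degree below that of Q lie outside the level set, so
  its \<epsilon> is below \<gamma>.\<close>

lemma key_polys_eq:
  fixes w :: "'c poly \<Rightarrow> 'l::divisible_linordered_ab_group_add top"
  assumes w: "is_valuation w"
  shows "key_polys (w \<circ> map_poly \<iota>) =
    (\<Union>\<gamma>. min_poly \<iota> ` Min_over \<iota> {b. top.Value \<gamma> \<le> w [:- b, 1:]})"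
proof (intro equalityI subsetI)
  fix Q
  assume Q: "Q \<in> key_polys (w \<circ> map_poly \<iota>)"
  define \<gamma> where "\<gamma> = eps (w \<circ> map_poly \<iota>) Q"
  have deg: "0 < Polynomial.degree Q" and monic: "Polynomial.lead_coeff Q = 1"
    using Q by (auto simp: key_polys_def)
  obtain c where c: "poly (map_poly \<iota> Q) c = 0" "w [:- c, 1:] = top.Value \<gamma>"
    using obtain_eps[OF w deg] unfolding \<gamma>_def by metis
  have min: "Polynomial.degree Q \<le> deg_over \<iota> b" if b: "top.Value \<gamma> \<le> w [:- b, 1:]" for b
  proof (rule ccontr)
    assume "\<not> ?thesis"
    moreover have pos: "0 < Polynomial.degree (min_poly \<iota> b)"
      using deg_over_pos[of b] by (simp add: deg_over_def)
    ultimately have "eps (w \<circ> map_poly \<iota>) (min_poly \<iota> b) < \<gamma>"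
      using Q by (simp add: key_polys_def \<gamma>_def deg_over_def)
    moreover have "w [:- b, 1:] \<le> top.Value (eps (w \<circ> map_poly \<iota>) (min_poly \<iota> b))"
      using obtain_eps[OF w pos] poly_min_poly by metis
    ultimately show False
      using b by (metis leD less_top_Value order_trans)
  qed
  \<comment> \<open>One bound holds because c lies in the level set, the other because c is a root
    of Q.\<close>
  have "deg_over \<iota> c = Polynomial.degree Q"
    using min[of c] deg_over_le[of Q c] deg c by (cases "Q = 0") auto
  then have "min_poly \<iota> c = Q" "c \<in> Min_over \<iota> {b. top.Value \<gamma> \<le> w [:- b, 1:]}"
    using min c monic min_poly_eq_of_degree by (auto simp: Min_over_iff)
  then show "Q \<in> (\<Union>\<gamma>. min_poly \<iota> ` Min_over \<iota> {b. top.Value \<gamma> \<le> w [:- b, 1:]})"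
    by blast
next
  fix Q
  assume "Q \<in> (\<Union>\<gamma>. min_poly \<iota> ` Min_over \<iota> {b. top.Value \<gamma> \<le> w [:- b, 1:]})"
  then obtain \<gamma> c where Q: "Q = min_poly \<iota> c" and c: "top.Value \<gamma> \<le> w [:- c, 1:]"
    and min: "\<And>b. top.Value \<gamma> \<le> w [:- b, 1:] \<Longrightarrow> deg_over \<iota> c \<le> deg_over \<iota> b"
    by (auto simp: Min_over_iff)
  have deg: "0 < Polynomial.degree Q"
    using deg_over_pos[of c] by (simp add: deg_over_def Q)
  have "w [:- c, 1:] \<le> top.Value (eps (w \<circ> map_poly \<iota>) Q)"
    using obtain_eps[OF w deg] poly_min_poly Q by metis
  with c have ge: "top.Value \<gamma> \<le> top.Value (eps (w \<circ> map_poly \<iota>) Q)"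
    by (rule order_trans)
  have "eps (w \<circ> map_poly \<iota>) f < eps (w \<circ> map_poly \<iota>) Q"
    if f: "0 < Polynomial.degree f" "Polynomial.degree f < Polynomial.degree Q" for f
  proof -
    obtain b where b: "poly (map_poly \<iota> f) b = 0"
      "w [:- b, 1:] = top.Value (eps (w \<circ> map_poly \<iota>) f)"
      using obtain_eps[OF w f(1)] by metis
    have "deg_over \<iota> b < deg_over \<iota> c"
      using deg_over_le[of f b] b f by (cases "f = 0") (auto simp: Q deg_over_def)
    then have "\<not> top.Value \<gamma> \<le> w [:- b, 1:]"
      using min[of b] by auto
    with b ge show ?thesis
      by simp
  qed
  with deg lead_coeff_min_poly[of c] show "Q \<in> key_polys (w \<circ> map_poly \<iota>)"
    by (simp add: key_polys_def Q)
qed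

end

section \<open>The chain of balls\<close>

locale ball_valuation = valuation v for v :: "'c::field \<Rightarrow> 'l::linordered_ab_group_add top"
begin

lemma minus_commute: "v (a - b) = v (b - a)"
  using minus[of "a - b"] by simp

lemma center_in_ball [simp]: "a \<in> val_ball v a \<delta>"
  by (simp add: val_ball_def)

text \<open>The ultrametric inequality gives one inclusion. Being in the ball of radius \<delta>
  around a point is symmetric, so the same inclusion applies with the centres exchanged.\<close>

lemma val_ball_eq:
  assumes "c \<in> val_ball v a \<delta>"
  shows "val_ball v c \<delta> = val_ball v a \<delta>"
proof -
  have *: "val_ball v c \<delta> \<subseteq> val_ball v a \<delta>" if "c \<in> val_ball v a \<delta>" for a c
  proof
    fix b assume "b \<in> val_ball v c \<delta>"
    with that show "b \<in> val_ball v a \<delta>"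
      using add_geI[of "top.Value \<delta>" "b - c" "c - a"] by (simp add: val_ball_def)
  qed
  have "a \<in> val_ball v c \<delta>"
    using assms by (simp add: val_ball_def minus_commute)
  with assms show ?thesis
    using *[of c a] *[of a c] by blast
qed

text \<open>The expansion of x - b around a is (a - b) + 1 (x - a).\<close>

lemma ball_val_linear: "ball_val v a \<delta> [:- b, 1:] = min (v (a - b)) (top.Value \<delta>)"
proof -
  have "{..1::nat} = {0, 1}"
    by auto
  then show ?thesis
    by (simp add: ball_val_def pcompose_pCons nmult_Suc flip: zero_top_def)
qed

lemma ball_val_center: "ball_val v a \<delta> [:- a, 1:] = top.Value \<delta>"
  by (simp add: ball_val_linear)

lemma ball_supset:
  assumes "B \<in> val_balls v" "val_ball v a \<delta> \<subseteq> B"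
  obtains \<gamma> where "\<gamma> \<le> \<delta>" "B = val_ball v a \<gamma>"
proof -
  obtain c \<gamma> where B: "B = val_ball v c \<gamma>"
    using assms(1) by (auto simp: val_balls_def)
  have "a \<in> B"
    using assms(2) by auto
  then have B: "B = val_ball v a \<gamma>"
    using B val_ball_eq by blast
  show thesis
  proof (cases "\<gamma> \<le> \<delta>")
    case True
    then show thesis
      using B that by blast
  next
    case False
    \<comment> \<open>A ball does not determine its radius: here B is also contained in the ball of
      radius \<delta>, so the two coincide and \<delta> serves as the radius.\<close>
    then have "top.Value \<delta> \<le> top.Value \<gamma>"
      by simp
    then have "B \<subseteq> val_ball v a \<delta>"
      unfolding B val_ball_def by (blast intro: order_trans)
    then show thesis
      using assms(2) that[of \<delta>] by blast
  qed
qed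

text \<open>The polynomials x - c and x - b differ by the constant b - c, on which w agrees with
  v.\<close>

lemma level_set_eq_ball:
  assumes w: "w \<in> poly_valuations v" and c: "top.Value \<gamma> \<le> w [:- c, 1:]"
  shows "{b. top.Value \<gamma> \<le> w [:- b, 1:]} = val_ball v c \<gamma>"
proof -
  interpret w: valuation w
    using w by unfold_locales (simp add: poly_valuations_def)
  have const: "w [:a:] = v a" for a
    using w by (simp add: poly_valuations_def)
  show ?thesis
  proof (intro equalityI subsetI)
    fix b assume "b \<in> {b. top.Value \<gamma> \<le> w [:- b, 1:]}"
    then have "top.Value \<gamma> \<le> w ([:- c, 1:] - [:- b, 1:])"
      using c by (intro w.diff_geI) auto
    then show "b \<in> val_ball v c \<gamma>"
      by (simp add: const val_ball_def)
  next
    fix b assume "b \<in> val_ball v c \<gamma>"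
    then have "top.Value \<gamma> \<le> w ([:- c, 1:] - [:b - c:])"
      using c by (intro w.diff_geI) (auto simp: const val_ball_def)
    then show "b \<in> {b. top.Value \<gamma> \<le> w [:- b, 1:]}"
      by simp
  qed
qed

text \<open>The common form of the two cases in the definition of the chain: a single ball is a
  constant family.\<close>

lemma chain_eq_level_sets:
  assumes w: "w \<in> poly_valuations v"
    and below: "\<And>i. i \<in> I \<Longrightarrow> ball_val v (a i) (\<delta> i) \<le> w"
    and attained: "\<And>f. \<exists>i\<in>I. ball_val v (a i) (\<delta> i) f = w f"
  shows "{B \<in> val_balls v. \<exists>i\<in>I. val_ball v (a i) (\<delta> i) \<subseteq> B} =
    {D. D \<noteq> {} \<and> (\<exists>\<gamma>. D = {b. top.Value \<gamma> \<le> w [:- b, 1:]})}"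
proof (intro equalityI subsetI)
  fix B
  assume "B \<in> {B \<in> val_balls v. \<exists>i\<in>I. val_ball v (a i) (\<delta> i) \<subseteq> B}"
  then obtain i where i: "i \<in> I" "B \<in> val_balls v" "val_ball v (a i) (\<delta> i) \<subseteq> B"
    by blast
  then obtain \<gamma> where \<gamma>: "\<gamma> \<le> \<delta> i" "B = val_ball v (a i) \<gamma>"
    using ball_supset by blast
  \<comment> \<open>This chain of inequalities puts the centre \<open>a i\<close> into the level set
    of \<gamma>, which is therefore the ball of radius \<gamma> around it.\<close>
  have "top.Value \<gamma> \<le> top.Value (\<delta> i)"
    using \<gamma> by simp
  also have "\<dots> = ball_val v (a i) (\<delta> i) [:- a i, 1:]"
    by (simp add: ball_val_center)
  also have "\<dots> \<le> w [:- a i, 1:]"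
    using below[OF i(1)] by (rule le_funD)
  finally have "B = {b. top.Value \<gamma> \<le> w [:- b, 1:]}"
    using level_set_eq_ball[OF w] \<gamma> by simp
  moreover have "a i \<in> B"
    using \<gamma> by simp
  ultimately show "B \<in> {D. D \<noteq> {} \<and> (\<exists>\<gamma>. D = {b. top.Value \<gamma> \<le> w [:- b, 1:]})}"
    by blast
next
  fix D
  assume "D \<in> {D. D \<noteq> {} \<and> (\<exists>\<gamma>. D = {b. top.Value \<gamma> \<le> w [:- b, 1:]})}"
  then obtain \<gamma> c where D: "D = {b. top.Value \<gamma> \<le> w [:- b, 1:]}"
    and c: "top.Value \<gamma> \<le> w [:- c, 1:]"
    by blast
  have ball: "D = val_ball v c \<gamma>"
    using level_set_eq_ball[OF w c] D by simp
  obtain i where i: "i \<in> I" "ball_val v (a i) (\<delta> i) [:- c, 1:] = w [:- c, 1:]"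
    using attained by blast
  \<comment> \<open>The attained value of x - c is a minimum of two terms. The bound on the first
    makes \<open>a i\<close> a centre of D, the bound on the second puts the i-th ball inside
    D.\<close>
  then have "top.Value \<gamma> \<le> v (a i - c)" and le: "top.Value \<gamma> \<le> top.Value (\<delta> i)"
    using c unfolding ball_val_linear by (metis min.boundedE)+
  then have "D = val_ball v (a i) \<gamma>"
    using ball val_ball_eq by (simp add: val_ball_def)
  then have "val_ball v (a i) (\<delta> i) \<subseteq> D"
    using le unfolding val_ball_def by (blast intro: order_trans)
  moreover have "D \<in> val_balls v"
    using ball by (auto simp: val_balls_def)
  ultimately show "D \<in> {B \<in> val_balls v. \<exists>i\<in>I. val_ball v (a i) (\<delta> i) \<subseteq> B}"
    using i by blast
qed

text \<open>Describes the chain by w alone, independently of the chosen centre or family. Empty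
  level sets, which occur for \<gamma> above all values of the x - b, are left out because balls
  contain their centres.\<close>

lemma ball_chain_eq_level_sets:
  assumes w: "w \<in> poly_valuations v" and BB: "ball_chain \<iota> v I \<mu> w BB"
  shows "BB = {D. D \<noteq> {} \<and> (\<exists>\<gamma>. D = {b. top.Value \<gamma> \<le> w [:- b, 1:]})}"
proof (cases "valuation_transcendental \<mu>")
  case True
  then obtain a \<delta> where a: "w = ball_val v a \<delta>" "BB = {B \<in> val_balls v. val_ball v a \<delta> \<subseteq> B}"
    using BB by (auto simp: ball_chain_def)
  then show ?thesis
    using chain_eq_level_sets[OF w, of "{()}" "\<lambda>_. a" "\<lambda>_. \<delta>"] by simp
next
  case False
  then obtain a \<delta> where mono: "strict_mono_on I (\<lambda>i. ball_val v (a i) (\<delta> i))"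
    and lim: "stable_limit I (\<lambda>i. ball_val v (a i) (\<delta> i)) w"
    and BB': "BB = {B \<in> val_balls v. \<exists>i\<in>I. val_ball v (a i) (\<delta> i) \<subseteq> B}"
    using BB unfolding ball_chain_def by auto
  \<comment> \<open>An increasing family stays below its stable limit: compare i with an index k
    beyond both i and the point j where the values at f have stabilized.\<close>
  have "ball_val v (a i) (\<delta> i) f \<le> w f" if i: "i \<in> I" for i f
  proof -
    obtain j where j: "j \<in> I" "\<And>k. k \<in> I \<Longrightarrow> j \<le> k \<Longrightarrow> ball_val v (a k) (\<delta> k) f = w f"
      using lim unfolding stable_limit_def by blast
    define k where "k = max i j"
    have "k \<in> I" "i \<le> k" "j \<le> k"
      using i j by (auto simp: k_def max_def)
    then have "ball_val v (a i) (\<delta> i) \<le> ball_val v (a k) (\<delta> k)"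
      using strict_mono_onD[OF mono i \<open>k \<in> I\<close>] by (cases "i = k") (auto simp: less_imp_le)
    then show ?thesis
      using j(2)[OF \<open>k \<in> I\<close> \<open>j \<le> k\<close>] by (metis le_funD)
  qed
  moreover have "\<exists>i\<in>I. ball_val v (a i) (\<delta> i) f = w f" for f
    using lim unfolding stable_limit_def by blast
  ultimately show ?thesis
    unfolding BB' by (intro chain_eq_level_sets w) (auto simp: le_fun_def)
qed

end

theorem theorem4p2:
  fixes \<iota> :: "'k::field \<Rightarrow> 'c::alg_closed_field"
    and v :: "'c \<Rightarrow> 'l::divisible_linordered_ab_group_add top"
    and \<mu> :: "'k poly \<Rightarrow> 'l top"
    and \<mu>' :: "'c poly \<Rightarrow> 'l top"
    and I :: "'i::linorder set"
    and BB :: "'c set set"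
  assumes "algebraic_closure_of \<iota>"
    and "is_valuation v"
    and "\<mu> \<in> poly_valuations (v \<circ> \<iota>)"
    and "\<mu>' \<in> poly_valuations v"
    and "\<mu>' \<circ> map_poly \<iota> = \<mu>"
    and "ball_chain \<iota> v I \<mu> \<mu>' BB"
  shows "key_polys \<mu> = (\<Union>B\<in>BB. min_poly \<iota> ` Min_over \<iota> B)"
proof -
  interpret algebraic_closure_of \<iota> by fact
  interpret ball_valuation v by unfold_locales fact
  have \<mu>': "is_valuation \<mu>'"
    using assms(4) by (simp add: poly_valuations_def)
  have "BB = {D. D \<noteq> {} \<and> (\<exists>\<gamma>. D = {b. top.Value \<gamma> \<le> \<mu>' [:- b, 1:]})}"
    by (rule ball_chain_eq_level_sets) fact+
  \<comment> \<open>The union in \<open>key_polys_eq\<close> also runs over empty level sets; these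
    contribute nothing, since \<open>Min_over\<close> of a set lies inside that set.\<close>
  then show ?thesis
    unfolding assms(5)[symmetric] key_polys_eq[OF \<mu>'] by (blast dest: Min_overD)
qed

end
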